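(* Let $n$ and $k$ be positive integers. If $G \in \varPi(n;k)$, then $$\Delta(G) \leq \frac{n-k^2}{2},$$ where $\Delta(G)$ denotes the maximum degree of $G$.
   Context: All graphs are simple, finite and undirected. The detour order of a graph $G$ is the number of vertices of a longest path in $G$. A Hamilton path of a graph is a path through all of its vertices. For positive integers $n$ and $k$, $\varPi(n;k)$ denotes the set of graphs $G$ of order $n$ such that the detour order of $G$ equals $n-k$ and $G-S$ has a Hamilton path for every subset $S \subseteq V(G)$ with $|S|=k$.
   Formalization: The case n = k+1 with k ≥ 2 is excluded: there the edgeless graph on k+1 vertices lies in Π(n;k) with Δ(G) = 0, while (n−k²)/2 is negative, so the bound fails; no case where it holds is lost. *)

theory Defs
  imports Complex_Main "Graph_Theory.Graph_Theory"
begin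

text \<open>
  A finite simple undirected graph is a loop-free symmetric digraph without parallel arcs
  (\<^locale>\<open>graph\<close>): an edge \<open>uv\<close> is the pair of arcs \<open>(u,v)\<close>, \<open>(v,u)\<close>, so the degree
  of \<open>v\<close> is its out-degree. A path is a nonempty list of distinct vertices (\<^const>\<open>vpath\<close>);
  a single vertex is a path. Detour order and maximum degree are meaningful only for graphs
  with at least one vertex.
\<close>

definition detour_order :: "('a, 'b) pre_digraph \<Rightarrow> nat" where
  "detour_order G = Max (length ` {p. vpath p G})"

definition hamilton_path :: "'a vwalk \<Rightarrow> ('a, 'b) pre_digraph \<Rightarrow> bool" where
  "hamilton_path p G \<longleftrightarrow> vpath p G \<and> set p = verts G"

definition max_degree :: "('a, 'b) pre_digraph \<Rightarrow> nat" where
  "max_degree G = Max (out_degree G ` verts G)"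

text \<open>Writing \<open>detour_order G + k = n\<close> avoids truncated subtraction when \<open>n < k\<close>.\<close>

definition Pi_graphs :: "nat \<Rightarrow> nat \<Rightarrow> ('a, 'b) pre_digraph set" where
  "Pi_graphs n k = {G. graph G \<and> card (verts G) = n \<and> detour_order G + k = n \<and>
     (\<forall>S. S \<subseteq> verts G \<and> card S = k \<longrightarrow> (\<exists>p. hamilton_path p (G \<restriction> (verts G - S))))}"

text \<open>
  The edgeless graph of order \<open>k + 1\<close> lies in \<open>\<Pi>(k + 1; k)\<close> and has maximum degree \<open>0\<close>, whereas
  \<open>((k + 1) - k\<^sup>2) / 2\<close> is negative for \<open>k \<ge> 2\<close>. The bound is therefore false for \<open>n = k + 1 \<ge> 3\<close>.
\<close>

lemma vpath_edgeless:
  assumes "arcs G = {}"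
  shows "vpath p G \<longleftrightarrow> (\<exists>v\<in>verts G. p = [v])"
  using assms by (cases p rule: vwalk_arcs.cases) (auto simp: vpath_def vwalk_def arcs_ends_def)

lemma edgeless_in_Pi_graphs:
  assumes "card (verts G) = k + 1" "arcs G = {}"
  shows "G \<in> Pi_graphs (k + 1) k" and "max_degree G = 0"
proof -
  have fin: "finite (verts G)" and ne: "verts G \<noteq> {}"
    using assms(1) by (auto intro: card_ge_0_finite)
  have "graph G"
    using fin assms(2) by unfold_locales (auto simp: symmetric_def arcs_ends_def sym_def)
  moreover have "length ` {p. vpath p G} = {1}"
    using ne by (force simp: vpath_edgeless[OF assms(2)])
  then have "detour_order G = 1" by (simp add: detour_order_def)
  moreover have "\<exists>p. hamilton_path p (G \<restriction> (verts G - S))"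
    if "S \<subseteq> verts G" "card S = k" for S
  proof -
    have "card (verts G - S) = 1"
      using that assms(1) fin by (simp add: card_Diff_subset finite_subset)
    then obtain v where v: "verts G - S = {v}" by (auto simp: card_1_singleton_iff)
    have "arcs (G \<restriction> {v}) = {}" using assms(2) by (simp add: induce_subgraph_def)
    then have "hamilton_path [v] (G \<restriction> {v})"
      by (simp add: hamilton_path_def vpath_edgeless)
    with v show ?thesis by auto
  qed
  ultimately show "G \<in> Pi_graphs (k + 1) k"
    using assms(1) by (auto simp: Pi_graphs_def)
  have "out_degree G ` verts G = {0}"
    using ne assms(2) by (auto simp: out_degree_def out_arcs_def)
  then show "max_degree G = 0" by (simp add: max_degree_def)
qed

end

theory Submission
  imports Defs
begin

text \<open>
  Let \<open>m = n - k\<close> be the detour order and \<open>v\<close> a vertex of maximum degree \<open>\<Delta>\<close>. Some induced path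
  \<open>s\<close> on \<open>k\<close> vertices starts at \<open>v\<close>. The graph without \<open>s\<close> has a Hamilton path \<open>p\<close>; it has \<open>m\<close>
  vertices and cannot be lengthened by detours through \<open>s\<close>, so the neighbours of \<open>s\<close> are far apart
  on \<open>p\<close>. If \<open>d x\<close> is the number of neighbours on \<open>p\<close> of a vertex \<open>x\<close> of \<open>s\<close>, the distances add
  up to \<open>m \<ge> k + d v + (\<Sum>x. d x)\<close>. If \<open>k \<ge> 2\<close>, all degrees are at least \<open>k + 1\<close> and \<open>s\<close> is induced, so
  \<open>d v = \<Delta> - 1\<close>, the other end has \<open>d x \<ge> k\<close>, and the \<open>k - 2\<close> inner vertices have
  \<open>d x \<ge> k - 1\<close>. Hence \<open>m \<ge> 2 * \<Delta> + k\<^sup>2 - k\<close>.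
\<close>

section \<open>Arithmetic of widely spaced positions\<close>

text \<open>The two end bounds and the gaps between consecutive positions telescope to
  \<open>2 * m\<close>; each \<open>c q\<close> is charged once to the left and once to the right of
  \<open>q\<close>.\<close>

lemma spread_sum_bound:
  fixes Q :: "nat set" and c :: "nat \<Rightarrow> nat"
  assumes "finite Q" "Q \<noteq> {}"
    and left: "\<And>q. q \<in> Q \<Longrightarrow> k + c q \<le> 2 * q"
    and gap: "\<And>q r. q \<in> Q \<Longrightarrow> r \<in> Q \<Longrightarrow> q < r \<Longrightarrow> 2 * q + c q + c r + 2 \<le> 2 * r"
    and right: "\<And>q. q \<in> Q \<Longrightarrow> 2 * q + 2 + k + c q \<le> 2 * m"
  shows "k + card Q + sum c Q \<le> m"
proof -
  \<comment> \<open>Positions are inserted in increasing order. The largest one has been charged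
    only on its left so far; the summand \<open>c (Max Q)\<close> is the charge still owed on its
    right.\<close>
  have "k + 2 * card Q + 2 * sum c Q \<le> 2 * Max Q + 2 + c (Max Q)"
    using assms(1,2) left gap
  proof (induction rule: finite_linorder_max_induct)
    case empty
    then show ?case by simp
  next
    case (insert b A)
    have "b \<notin> A" using insert.hyps by auto
    have mx: "Max (insert b A) = b"
      using insert.hyps by (intro Max_eqI) auto
    show ?case
    proof (cases "A = {}")
      case True
      then show ?thesis using insert.prems(2)[of b] by simp
    next
      case False
      then have "Max A \<in> A" using insert.hyps by simp
      moreover have "k + 2 * card A + 2 * sum c A \<le> 2 * Max A + 2 + c (Max A)"
        using insert False by auto
      moreover have "2 * Max A + c (Max A) + c b + 2 \<le> 2 * b"
        using insert.prems(3)[of "Max A" b] insert.hyps \<open>Max A \<in> A\<close> by auto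
      ultimately show ?thesis
        using insert.hyps \<open>b \<notin> A\<close> by (simp add: mx)
    qed
  qed
  moreover have "2 * Max Q + 2 + k + c (Max Q) \<le> 2 * m"
    using assms(1,2) right by simp
  ultimately show ?thesis by simp
qed

lemma card_le_Max_minus_Min:
  fixes A :: "nat set"
  assumes "finite A" "A \<noteq> {}"
  shows "card A \<le> Max A - Min A + 1"
proof -
  have "A \<subseteq> {Min A..Max A}" using assms by auto
  from card_mono[OF _ this] have "card A \<le> Suc (Max A) - Min A" by simp
  then show ?thesis by (simp add: Suc_diff_le assms)
qed

section \<open>Adjacency setting and rerouting of longest paths\<close>

text \<open>The graphs of \<open>Pi_graphs (m + k) k\<close> as an adjacency relation, so that
  rerouting a path is concatenation of lists. The empty list counts as a path, which matters only
  for \<open>m = 0\<close>.\<close>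

locale k_deleted_traceable =
  fixes V :: "'a set" and E :: "'a \<Rightarrow> 'a \<Rightarrow> bool" and k m :: nat
  assumes finite_V: "finite V"
    and E_V: "E x y \<Longrightarrow> y \<in> V"
    and E_sym: "E x y \<Longrightarrow> E y x"
    and E_irrefl: "\<not> E x x"
    and card_V: "card V = m + k"
    and longest: "distinct p \<Longrightarrow> set p \<subseteq> V \<Longrightarrow> successively E p \<Longrightarrow> length p \<le> m"
    and traceable: "S \<subseteq> V \<Longrightarrow> card S = k \<Longrightarrow>
      \<exists>p. distinct p \<and> set p = V - S \<and> successively E p"
begin

definition nbrs :: "'a \<Rightarrow> 'a set" where
  "nbrs u = {w. E u w}"

lemma finite_nbrs [simp]: "finite (nbrs u)"
  by (rule finite_subset[OF _ finite_V]) (auto simp: nbrs_def E_V)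

lemma E_commute: "E x y \<longleftrightarrow> E y x"
  using E_sym by blast

lemma successively_rev_E [simp]: "successively (\<lambda>x y. E y x) p \<longleftrightarrow> successively E p"
  by (simp add: E_commute)

lemma successively_take: "successively E p \<Longrightarrow> successively E (take i p)"
  by (auto simp: successively_conv_nth)

lemma successively_drop: "successively E p \<Longrightarrow> successively E (drop i p)"
  by (auto simp: successively_conv_nth)

lemma hamilton_path_of_deleted:
  assumes "S \<subseteq> V" "card S = k"
  obtains p where "distinct p" "set p = V - S" "successively E p" "length p = m"
proof -
  obtain p where p: "distinct p" "set p = V - S" "successively E p"
    using traceable[OF assms] by blast
  have "length p = card (V - S)" using p distinct_card by metis
  also have "\<dots> = m"
    using assms finite_V card_V by (simp add: card_Diff_subset finite_subset)
  finally show ?thesis using p that by blast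
qed

text \<open>Replacing the stretch of \<open>p\<close> strictly between positions \<open>i\<close>
  and \<open>j\<close> by \<open>r\<close> gives a path on \<open>i + 1 + length r + (m - j)\<close>
  vertices, which cannot exceed \<open>m\<close>.\<close>

lemma detour_inside:
  assumes p: "distinct p" "set p \<subseteq> V" "successively E p" "length p = m"
    and r: "distinct r" "set r \<subseteq> V - set p" "successively E r" "r \<noteq> []"
    and ij: "i < j" "j < m" "E (p ! i) (hd r)" "E (last r) (p ! j)"
  shows "length r + i + 1 \<le> j"
proof -
  let ?q = "take (Suc i) p @ r @ drop j p"
  have "distinct ?q"
    using p(1) r(1,2) ij(1) set_take_disj_set_drop_if_distinct[of p "Suc i" j]
    by (auto dest: in_set_takeD in_set_dropD)
  moreover have "set ?q \<subseteq> V"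
    using p(2) r(2) by (auto dest: in_set_takeD in_set_dropD)
  moreover have "last (take (Suc i) p) = p ! i"
    using ij p(4) by (simp add: take_Suc_conv_app_nth)
  then have "successively E ?q"
    using p r ij by (auto simp: successively_append_iff successively_take successively_drop hd_drop_conv_nth)
  ultimately have "length ?q \<le> m" by (rule longest)
  then show ?thesis using p(4) ij by simp
qed

lemma detour_at_start:
  assumes p: "distinct p" "set p \<subseteq> V" "successively E p" "length p = m"
    and r: "distinct r" "set r \<subseteq> V - set p" "successively E r" "r \<noteq> []"
    and i: "i < m" "E (last r) (p ! i)"
  shows "length r \<le> i"
proof -
  let ?q = "r @ drop i p"
  have "distinct ?q" "set ?q \<subseteq> V"
    using p(1,2) r(1,2) by (auto dest: in_set_dropD)
  moreover have "successively E ?q"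
    using p r i by (auto simp: successively_append_iff successively_drop hd_drop_conv_nth)
  ultimately have "length ?q \<le> m" by (rule longest)
  then show ?thesis using p(4) i by simp
qed

lemma detour_at_end:
  assumes p: "distinct p" "set p \<subseteq> V" "successively E p" "length p = m"
    and r: "distinct r" "set r \<subseteq> V - set p" "successively E r" "r \<noteq> []"
    and i: "i < m" "E (last r) (p ! i)"
  shows "length r + i + 1 \<le> m"
proof -
  have "rev p ! (m - Suc i) = p ! i"
    using i p(4) by (simp add: rev_nth)
  then have "length r \<le> m - Suc i"
    using p r i by (intro detour_at_start[of "rev p"]) auto
  then show ?thesis using i by simp
qed

text \<open>A stretch of \<open>s\<close>, read backwards if \<open>b < a\<close>: a detour may
  enter and leave \<open>s\<close> at any two indices, in either order.\<close>

lemma subpath: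
  assumes s: "distinct s" "successively E s" and ab: "a < length s" "b < length s"
  obtains r where "distinct r" "set r \<subseteq> set s" "successively E r" "r \<noteq> []"
    "hd r = s ! a" "last r = s ! b" "length r = nat \<bar>int a - int b\<bar> + 1"
proof -
  have le: "\<exists>r. distinct r \<and> set r \<subseteq> set s \<and> successively E r \<and> r \<noteq> [] \<and>
      hd r = s ! a \<and> last r = s ! b \<and> length r = nat \<bar>int a - int b\<bar> + 1"
    if "a \<le> b" "b < length s" for a b
  proof (intro exI conjI)
    let ?r = "drop a (take (Suc b) s)"
    show "set ?r \<subseteq> set s" by (meson in_set_dropD in_set_takeD subsetI)
    show "last ?r = s ! b" using that by (simp add: take_Suc_conv_app_nth)
  qed (use s that in \<open>auto simp: successively_take successively_drop hd_drop_conv_nth\<close>)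
  show ?thesis
  proof (cases "a \<le> b")
    case True
    then show ?thesis using le ab that by blast
  next
    case False
    then obtain r where "distinct r" "set r \<subseteq> set s" "successively E r" "r \<noteq> []"
      "hd r = s ! b" "last r = s ! a" "length r = nat \<bar>int b - int a\<bar> + 1"
      using le[of b a] ab by auto
    then show ?thesis
      by (intro that[of "rev r"]) (auto simp: hd_rev last_rev)
  qed
qed

section \<open>Minimum degree and induced paths\<close>

text \<open>Otherwise some \<open>k\<close>-set avoiding \<open>u\<close> contains all neighbours of
  \<open>u\<close>. Deleting it isolates \<open>u\<close>, yet \<open>u\<close> lies on a Hamilton
  path of the remaining \<open>m \<ge> 2\<close> vertices.\<close>

lemma degree_ge:
  assumes "2 \<le> m" "u \<in> V"
  shows "k + 1 \<le> card (nbrs u)"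
proof (rule ccontr)
  assume "\<not> ?thesis"
  moreover have "nbrs u \<subseteq> V - {u}" by (auto simp: nbrs_def E_V E_irrefl)
  moreover have "k \<le> card (V - {u})" using assms card_V finite_V by simp
  ultimately obtain S where S: "nbrs u \<subseteq> S" "S \<subseteq> V - {u}" "card S = k"
    using exists_subset_between[of "nbrs u" k "V - {u}"] finite_V by auto
  then have "S \<subseteq> V" by blast
  then obtain p where p: "distinct p" "set p = V - S" "successively E p" "length p = m"
    using hamilton_path_of_deleted S(3) by metis
  have "u \<in> set p" using p S assms by blast
  then obtain i where i: "i < m" "p ! i = u"
    using p(4) by (metis in_set_conv_nth)
  have nth: "p ! j \<notin> nbrs u" if "j < m" for j
    using p S that nth_mem by fastforce
  show False
  proof (cases "Suc i < m")
    case True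
    then show ?thesis using nth[of "Suc i"] p i successively_nth[of E p i] by (simp add: nbrs_def)
  next
    case False
    then obtain j where "i = Suc j" using assms i by (cases i) auto
    then show ?thesis
      using nth[of j] p i successively_nth[of E p j] by (simp add: nbrs_def E_commute)
  qed
qed

text \<open>
  The last vertex \<open>u\<close> of \<open>s\<close> has a neighbour \<open>a\<close> on a Hamilton path of the graph with a set
  \<open>S \<supseteq> set (butlast s)\<close> avoiding \<open>u\<close> deleted. If \<open>a\<close> had a neighbour in \<open>butlast s\<close>, the
  Hamilton path could be rerouted through \<open>butlast s\<close> between \<open>u\<close> and \<open>a\<close>, and become too long.
\<close>
lemma chordless_extension:
  assumes "2 \<le> m" and s: "s \<noteq> []" "distinct s" "set s \<subseteq> V" "successively E s" "length s \<le> k"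
  obtains a where "a \<in> V" "a \<notin> set s" "E (last s) a" "\<And>x. x \<in> set (butlast s) \<Longrightarrow> \<not> E x a"
proof -
  let ?u = "last s" and ?R = "butlast s"
  have sR: "s = ?R @ [?u]" using s by simp
  have "distinct (?R @ [?u])" "set (?R @ [?u]) \<subseteq> V" "successively E (?R @ [?u])"
    using s sR by simp_all
  then have u: "?u \<in> V" "?u \<notin> set ?R"
    and R: "distinct ?R" "set ?R \<subseteq> V - {?u}" "successively E ?R"
    and last_R: "?R \<noteq> [] \<Longrightarrow> E (last ?R) ?u"
    by (auto simp: successively_append_iff simp del: append_butlast_last_id)
  have "card (set ?R) \<le> k" "k \<le> card (V - {?u})"
    using s(5) card_length[of ?R] assms u card_V finite_V by auto
  then obtain S where S: "set ?R \<subseteq> S" "S \<subseteq> V - {?u}" "card S = k"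
    using exists_subset_between[of "set ?R" k "V - {?u}"] R finite_V by auto
  then have "S \<subseteq> V" by blast
  then obtain p where p: "distinct p" "set p = V - S" "successively E p" "length p = m"
    using hamilton_path_of_deleted S(3) by metis
  have "?u \<in> set p" using p S u by blast
  then obtain i where i: "i < m" "p ! i = ?u"
    using p(4) by (metis in_set_conv_nth)
  \<comment> \<open>A path inside \<open>?R\<close> from \<open>x\<close> to \<open>y\<close> could
    be inserted between two consecutive vertices of \<open>p\<close>, where
    \<open>detour_inside\<close> leaves no room.\<close>
  have no_link: False if ij: "Suc i < m" and xy: "x \<in> set ?R" "y \<in> set ?R" "E (p ! i) x" "E y (p ! Suc i)" for i x y
  proof -
    obtain b c where "b < length ?R" "c < length ?R" "?R ! b = x" "?R ! c = y"
      using xy by (metis in_set_conv_nth)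
    then obtain r where r: "distinct r" "set r \<subseteq> set ?R" "successively E r" "r \<noteq> []" "hd r = x" "last r = y"
      using subpath[OF R(1,3), of b c] by metis
    then have "length r + i + 1 \<le> Suc i"
      using p S ij xy by (intro detour_inside[of p r i "Suc i"]) auto
    then show False using r by simp
  qed
  have no_chord: "\<not> E x a" if "x \<in> set ?R" and
    a: "Suc i < m \<and> a = p ! Suc i \<or> (\<exists>j. i = Suc j \<and> a = p ! j)" for x a
  proof
    assume "E x a"
    have "?R \<noteq> []" using that(1) by auto
    then have last: "last ?R \<in> set ?R" "E (last ?R) ?u"
      using last_R by simp_all
    \<comment> \<open>If \<open>a\<close> follows \<open>?u\<close> on \<open>p\<close>, the
      inserted path runs from \<open>last ?R\<close> to \<open>x\<close>; if \<open>a\<close>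
      precedes \<open>?u\<close>, it runs from \<open>x\<close> to \<open>last ?R\<close>.\<close>
    from a show False
      using no_link[of i "last ?R" x] no_link[of "i - 1" x "last ?R"] last i that(1) \<open>E x a\<close>
      by (auto simp: E_commute)
  qed
  obtain a where a: "Suc i < m \<and> a = p ! Suc i \<or> (\<exists>j. i = Suc j \<and> a = p ! j)"
    using assms(1) i by (cases i) auto
  moreover have "E (p ! j) (p ! Suc j)" if "Suc j < m" for j
    using p(3,4) that by (simp add: successively_nth)
  ultimately have "E ?u a"
    using i E_sym by metis
  moreover have "a \<in> set p"
    using a i p(4) by auto
  moreover have "a \<notin> set s"
  proof
    assume "a \<in> set s"
    also have "set s = insert ?u (set ?R)" by (subst sR) simp
    finally show False using \<open>a \<in> set p\<close> \<open>E ?u a\<close> p S E_irrefl by auto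
  qed
  ultimately show ?thesis
    using that[of a] no_chord a p by blast
qed

text \<open>Iterates \<open>chordless_extension\<close> from \<open>[v]\<close>: each appended
  vertex is adjacent to the current last vertex only, so no chord arises.\<close>

lemma induced_path:
  assumes "2 \<le> m" "v \<in> V" "1 \<le> j" "j \<le> k"
  obtains s where "length s = j" "distinct s" "set s \<subseteq> V" "s ! 0 = v"
    "\<And>a b. a < j \<Longrightarrow> b < j \<Longrightarrow> E (s ! a) (s ! b) \<longleftrightarrow> b = Suc a \<or> a = Suc b"
proof -
  have "\<exists>s. length s = j \<and> distinct s \<and> set s \<subseteq> V \<and> s ! 0 = v \<and>
    (\<forall>a<j. \<forall>b<j. E (s ! a) (s ! b) \<longleftrightarrow> b = Suc a \<or> a = Suc b)"
    using assms(3,4)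
  proof (induction rule: dec_induct)
    case base
    then show ?case using assms E_irrefl by (intro exI[of _ "[v]"]) auto
  next
    case (step j)
    then obtain s where s: "length s = j" "distinct s" "set s \<subseteq> V" "s ! 0 = v"
      and ind: "\<And>a b. a < j \<Longrightarrow> b < j \<Longrightarrow> E (s ! a) (s ! b) \<longleftrightarrow> b = Suc a \<or> a = Suc b"
      by auto
    have "s \<noteq> []" "successively E s"
      using s step ind by (auto simp: successively_conv_nth)
    then obtain w where w: "w \<in> V" "w \<notin> set s" "E (last s) w"
      "\<And>x. x \<in> set (butlast s) \<Longrightarrow> \<not> E x w"
      using chordless_extension[OF assms(1), of s] s step by auto
    have Ew: "E (s ! a) w \<longleftrightarrow> j = Suc a" if "a < j" for a
    proof (cases "j = Suc a")
      case True
      then show ?thesis using w s \<open>s \<noteq> []\<close> by (simp add: last_conv_nth)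
    next
      case False
      then have "a < length (butlast s)" using that s by simp
      then have "s ! a \<in> set (butlast s)" using nth_butlast nth_mem by metis
      then show ?thesis using w False by auto
    qed
    show ?case
      using s w ind Ew E_irrefl step.hyps
      by (intro exI[of _ "s @ [w]"]) (auto simp: nth_append less_Suc_eq E_commute[of w])
  qed
  then show ?thesis using that by blast
qed

section \<open>Counting neighbours along the Hamilton path\<close>

text \<open>
  A position \<open>q\<close> of \<open>p\<close> is labelled by the set \<open>A q\<close> of indices of its neighbours on \<open>s\<close>. Rerouting
  \<open>p\<close> through \<open>s\<close> bounds the distance between labelled positions from below by the difference of any
  two of their labels; averaging the choices (Max, Min) and (Min, Max) yields the gap bound of
  \<open>spread_sum_bound\<close> with \<open>c q = Max (A q) - Min (A q) + 1\<close>.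
\<close>
lemma sum_nbrs_outside_path:
  assumes s: "length s = k" "distinct s" "set s \<subseteq> V" "successively E s"
    and "1 \<le> k" and v: "v \<in> set s" "\<not> nbrs v \<subseteq> set s"
  shows "k + card (nbrs v - set s) + (\<Sum>a<k. card (nbrs (s ! a) - set s)) \<le> m"
proof -
  have "card (set s) = k" using s distinct_card by metis
  then obtain p where p: "distinct p" "set p = V - set s" "successively E p" "length p = m"
    using hamilton_path_of_deleted[of "set s"] s by auto
  define A where "A q = {a. a < k \<and> E (p ! q) (s ! a)}" for q
  define Q where "Q = {q. q < m \<and> A q \<noteq> {}}"
  define c where "c q = Max (A q) - Min (A q) + 1" for q
  have finA [simp]: "finite (A q)" for q by (simp add: A_def)
  have finQ: "finite Q" by (simp add: Q_def)
  \<comment> \<open>Since \<open>p\<close> covers exactly \<open>V - set s\<close>, neighbours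
    outside \<open>s\<close> can be counted as positions on \<open>p\<close>.\<close>
  have card_nbrs: "card {q. q < m \<and> E x (p ! q)} = card (nbrs x - set s)" for x
  proof (rule bij_betw_same_card)
    have "(!) p ` {q. q < m \<and> E x (p ! q)} = nbrs x - set s" (is "?L = ?R")
    proof
      show "?L \<subseteq> ?R" using p nth_mem by (fastforce simp: nbrs_def)
      show "?R \<subseteq> ?L"
      proof
        fix y assume y: "y \<in> ?R"
        then have "y \<in> set p" using p E_V by (auto simp: nbrs_def)
        then obtain q where "q < m" "p ! q = y" using p(4) by (metis in_set_conv_nth)
        then show "y \<in> ?L" using y by (auto simp: nbrs_def)
      qed
    qed
    then show "bij_betw ((!) p) {q. q < m \<and> E x (p ! q)} (nbrs x - set s)"
      using p by (auto simp: bij_betw_def inj_on_def nth_eq_iff_index_eq)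
  qed
  have mem: "Max (A q) \<in> A q" "Min (A q) \<in> A q" "Min (A q) \<le> Max (A q)" if "q \<in> Q" for q
    using that by (auto simp: Q_def)
  \<comment> \<open>The detour has \<open>|a - b| + 1\<close> vertices, so \<open>r - q\<close> is
    at least \<open>|a - b| + 2\<close>; the conjunction resolves the absolute value.\<close>
  have gap: "q + b + 2 \<le> r + a \<and> q + a + 2 \<le> r + b"
    if qr: "q < r" "r < m" and ab: "a \<in> A q" "b \<in> A r" for q r a b
  proof -
    have "a < length s" "b < length s" using ab s by (auto simp: A_def)
    then obtain t where t: "distinct t" "set t \<subseteq> set s" "successively E t" "t \<noteq> []"
      "hd t = s ! a" "last t = s ! b" "length t = nat \<bar>int a - int b\<bar> + 1"
      using subpath[OF s(2,4)] by metis
    then have "length t + q + 1 \<le> r"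
      using p s qr ab by (intro detour_inside[of p t q r]) (auto simp: A_def E_commute)
    then show ?thesis using t(7) by linarith
  qed
  \<comment> \<open>The two portions of \<open>s\<close> ending in \<open>s ! a\<close> have
    \<open>a + 1\<close> and \<open>k - a\<close> vertices; each can replace what precedes position
    \<open>q\<close> on \<open>p\<close>, or what follows it.\<close>
  have ends: "length t \<le> q \<and> length t + q + 1 \<le> m"
    if "q < m" "a \<in> A q" "t = take (Suc a) s \<or> t = rev (drop a s)" for q a t
  proof -
    have a: "a < length s" "E (s ! a) (p ! q)" using that s by (auto simp: A_def E_commute)
    have "set t \<subseteq> set s"
      using that(3) set_take_subset set_drop_subset by fastforce
    then have "set t \<subseteq> V - set p" using s p by auto
    moreover have "distinct t" "successively E t" "t \<noteq> []"
      using that(3) a s by (auto simp: successively_take successively_drop)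
    moreover have "last t = s ! a"
      using that(3) a by (auto simp: last_rev hd_drop_conv_nth take_Suc_conv_app_nth)
    ultimately show ?thesis
      using detour_at_start[of p t q] detour_at_end[of p t q] p a that by auto
  qed
  have ends': "Suc a \<le> q \<and> k - a \<le> q \<and> Suc a + q + 1 \<le> m \<and> k - a + q + 1 \<le> m"
    if "q < m" "a \<in> A q" for q a
    using ends[OF that, of "take (Suc a) s"] ends[OF that, of "rev (drop a s)"] that s
    by (simp add: A_def)
  \<comment> \<open>Add the prefix bound for the index \<open>Max (A q)\<close> to the suffix bound
    for \<open>Min (A q)\<close>.\<close>
  have left: "k + c q \<le> 2 * q" and right: "2 * q + 2 + k + c q \<le> 2 * m" if "q \<in> Q" for q
  proof -
    have "q < m" using that by (simp add: Q_def)
    from ends'[OF this mem(1)[OF that]] ends'[OF this mem(2)[OF that]] mem(3)[OF that]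
    show "k + c q \<le> 2 * q" "2 * q + 2 + k + c q \<le> 2 * m"
      by (auto simp: c_def)
  qed
  have gapc: "2 * q + c q + c r + 2 \<le> 2 * r" if "q \<in> Q" "r \<in> Q" "q < r" for q r
  proof -
    have "r < m" using that by (simp add: Q_def)
    with gap[of q r "Max (A q)" "Min (A r)"] gap[of q r "Min (A q)" "Max (A r)"]
      mem[OF that(1)] mem[OF that(2)] that(3)
    show ?thesis unfolding c_def by linarith
  qed
  obtain j where j: "j < k" "s ! j = v" using v s by (metis in_set_conv_nth)
  \<comment> \<open>Neighbours of \<open>v\<close> on \<open>p\<close> occupy labelled positions, so
    \<open>card Q\<close> pays for the extra summand of \<open>v\<close>.\<close>
  have sub: "{q. q < m \<and> E v (p ! q)} \<subseteq> Q"
    using j by (auto simp: Q_def A_def E_commute)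
  have "card (nbrs v - set s) \<le> card Q"
    using card_mono[OF finQ sub] by (simp add: card_nbrs)
  moreover have "Q \<noteq> {}"
  proof -
    have "card (nbrs v - set s) \<noteq> 0" using v by simp
    then show ?thesis using \<open>card (nbrs v - set s) \<le> card Q\<close> by auto
  qed
  \<comment> \<open>Double counting of the edges between \<open>s\<close> and \<open>p\<close>;
    \<open>A q\<close> lies in an interval of \<open>c q\<close> integers.\<close>
  moreover have "(\<Sum>a<k. card (nbrs (s ! a) - set s)) \<le> sum c Q"
  proof -
    have "(\<Sum>a<k. card (nbrs (s ! a) - set s)) = (\<Sum>a<k. card {q \<in> {..<m}. E (s ! a) (p ! q)})"
      by (simp add: card_nbrs)
    also have "\<dots> = (\<Sum>q<m. card (A q))"
      by (subst sum_multicount_gen[of "{..<k}" "{..<m}" "\<lambda>a q. E (s ! a) (p ! q)" "\<lambda>q. card (A q)"])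
        (auto simp: A_def E_commute)
    also have "\<dots> = (\<Sum>q\<in>Q. card (A q))"
      by (rule sum.mono_neutral_right) (auto simp: Q_def)
    also have "\<dots> \<le> sum c Q"
      by (rule sum_mono) (auto simp: c_def Q_def intro!: card_le_Max_minus_Min[simplified])
    finally show ?thesis .
  qed
  moreover have "k + card Q + sum c Q \<le> m"
    using finQ \<open>Q \<noteq> {}\<close> left gapc right by (rule spread_sum_bound)
  ultimately show ?thesis by linarith
qed

section \<open>The degree bound for the adjacency relation\<close>

theorem degree_bound:
  assumes "1 \<le> k" "k = 1 \<or> 2 \<le> m" "v \<in> V"
  shows "2 * card (nbrs v) + k\<^sup>2 \<le> card V"
proof (cases "k = 1")
  case True
  show ?thesis
  proof (cases "nbrs v = {}")
    case True
    then show ?thesis using \<open>k = 1\<close> card_V by simp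
  next
    case False
    have "v \<notin> nbrs v" by (simp add: nbrs_def E_irrefl)
    with False have "\<not> nbrs v \<subseteq> set [v]" "nbrs v - {v} = nbrs v" by auto
    then show ?thesis
      using sum_nbrs_outside_path[of "[v]" v] True assms card_V by simp
  qed
next
  case False
  \<comment> \<open>\<open>l\<close> is the number of inner vertices of the induced path.\<close>
  then obtain l where k: "k = Suc (Suc l)" using assms(1) by (metis One_nat_def not0_implies_Suc not_one_le_zero)
  have m: "2 \<le> m" using assms False by simp
  obtain s where s: "length s = k" "distinct s" "set s \<subseteq> V" "s ! 0 = v"
    and ind: "\<And>a b. a < k \<Longrightarrow> b < k \<Longrightarrow> E (s ! a) (s ! b) \<longleftrightarrow> b = Suc a \<or> a = Suc b"
    using induced_path[OF m assms(3,1)] by blast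
  \<comment> \<open>\<open>I\<close> collects the indices next to \<open>a\<close>; as
    \<open>s\<close> is induced, only these can give neighbours of \<open>s ! a\<close> on
    \<open>s\<close>.\<close>
  have nb: "card (nbrs (s ! a)) \<le> card (nbrs (s ! a) - set s) + card I"
    if "a < k" "finite I" "\<And>b. b < k \<Longrightarrow> b = Suc a \<or> a = Suc b \<Longrightarrow> b \<in> I" for a I
  proof -
    have "nbrs (s ! a) \<subseteq> (nbrs (s ! a) - set s) \<union> (!) s ` I"
    proof
      fix y assume y: "y \<in> nbrs (s ! a)"
      show "y \<in> (nbrs (s ! a) - set s) \<union> (!) s ` I"
      proof (cases "y \<in> set s")
        case True
        then obtain b where "b < k" "y = s ! b" using s by (metis in_set_conv_nth)
        then show ?thesis using y ind[of a b] that by (auto simp: nbrs_def)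
      qed (use y in auto)
    qed
    then have "card (nbrs (s ! a)) \<le> card ((nbrs (s ! a) - set s) \<union> (!) s ` I)"
      by (intro card_mono) (use that in auto)
    also have "\<dots> \<le> card (nbrs (s ! a) - set s) + card ((!) s ` I)"
      by (rule card_Un_le)
    finally show ?thesis using card_image_le[OF that(2), of "(!) s"] by linarith
  qed
  have deg: "k + 1 \<le> card (nbrs (s ! a))" if "a < k" for a
    using that s degree_ge[OF m] by (metis nth_mem subsetD)
  define f where "f a = card (nbrs (s ! a) - set s)" for a
  have first: "card (nbrs v) \<le> f 0 + 1"
    using nb[of 0 "{1}"] k s by (auto simp: f_def)
  have middle: "l + 1 \<le> f (Suc a)" if "a < l" for a
  proof -
    have "card {a, Suc (Suc a)} = 2" by simp
    with nb[of "Suc a" "{a, Suc (Suc a)}"] deg[of "Suc a"] k that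
    show ?thesis by (fastforce simp: f_def)
  qed
  have last: "k \<le> f (Suc l)"
    using nb[of "Suc l" "{l}"] deg[of "Suc l"] k by (fastforce simp: f_def)
  \<comment> \<open>\<open>v\<close> has at least \<open>k + 1\<close> neighbours, at most one of
    them on \<open>s\<close>.\<close>
  have "f 0 \<noteq> 0" using first deg[of 0] k s by auto
  then have out: "\<not> nbrs v \<subseteq> set s" using s by (auto simp: f_def)
  have "successively E s" using ind s by (auto simp: successively_conv_nth)
  moreover have "v \<in> set s" using s k by (metis nth_mem zero_less_Suc)
  ultimately have "k + f 0 + (\<Sum>a<k. f a) \<le> m"
    using sum_nbrs_outside_path[of s v] s out assms(1) by (simp add: f_def)
  moreover have "(\<Sum>a<k. f a) = f 0 + (\<Sum>a<l. f (Suc a)) + f (Suc l)"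
    unfolding k by (subst sum.lessThan_Suc, subst sum.lessThan_Suc_shift) simp
  moreover have "l * (l + 1) \<le> (\<Sum>a<l. f (Suc a))"
    using sum_bounded_below[of "{..<l}" "l + 1" "\<lambda>a. f (Suc a)"] middle by simp
  \<comment> \<open>\<open>f 0\<close> occurs twice, once from the sum and once as the extra summand
    of \<open>v\<close>. Adding the \<open>k\<close> vertices of \<open>s\<close> gives
    \<open>3 * k + l * (l + 1) = k\<^sup>2 + 2\<close>, and this 2 pays for the neighbour of
    \<open>v\<close> on \<open>s\<close>, counted twice.\<close>
  ultimately have "2 * k + 2 * f 0 + l * (l + 1) \<le> m" using last by linarith
  moreover have "k\<^sup>2 = l * (l + 1) + 3 * l + 4"
    by (simp add: k power2_eq_square algebra_simps)
  ultimately show ?thesis using first card_V k by linarith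
qed

end

section \<open>Transfer to graphs\<close>

lemma vpath_iff_successively:
  "vpath p G \<longleftrightarrow> p \<noteq> [] \<and> distinct p \<and> set p \<subseteq> verts G \<and> successively (dominates G) p"
proof -
  have "set (vwalk_arcs p) \<subseteq> arcs_ends G \<longleftrightarrow> successively (dominates G) p"
    by (induction p rule: vwalk_arcs.induct) auto
  then show ?thesis by (auto simp: vpath_def vwalk_def)
qed

text \<open>Without parallel arcs, an arc leaving \<open>v\<close> is determined by its
  head.\<close>

lemma (in graph) out_degree_conv_card_dominates:
  "out_degree G v = card {w. v \<rightarrow>\<^bsub>G\<^esub> w}"
  unfolding out_degree_def
proof (rule bij_betw_same_card)
  show "bij_betw (head G) (out_arcs G v) {w. v \<rightarrow>\<^bsub>G\<^esub> w}"
    unfolding bij_betw_def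
  proof
    show "inj_on (head G) (out_arcs G v)"
      by (auto simp: inj_on_def arc_to_ends_def intro!: no_multi_arcs)
    show "head G ` out_arcs G v = {w. v \<rightarrow>\<^bsub>G\<^esub> w}"
      by (auto simp: arcs_ends_conv)
  qed
qed

text \<open>Makes the \<open>Max\<close> in \<open>detour_order\<close> a genuine maximum.\<close>

lemma finite_vpaths:
  assumes "finite (verts G)"
  shows "finite {p. vpath p G}"
  by (rule finite_subset[OF _ finite_subset_distinct[OF assms]])
    (auto simp: vpath_iff_successively)

lemma (in graph) Pi_graphs_imp_k_deleted_traceable:
  assumes "G \<in> Pi_graphs n k"
  shows "k_deleted_traceable (verts G) (dominates G) k (detour_order G)"
proof
  have G: "card (verts G) = n" "detour_order G + k = n"
    "\<And>S. S \<subseteq> verts G \<Longrightarrow> card S = k \<Longrightarrow> \<exists>p. hamilton_path p (G \<restriction> (verts G - S))"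
    using assms by (auto simp: Pi_graphs_def)
  show "finite (verts G)" by simp
  show "y \<in> verts G" if "x \<rightarrow>\<^bsub>G\<^esub> y" for x y using that adj_in_verts by blast
  show "y \<rightarrow>\<^bsub>G\<^esub> x" if "x \<rightarrow>\<^bsub>G\<^esub> y" for x y
    using that by (rule arcs_ends_symmetric[OF sym_arcs])
  show "\<not> x \<rightarrow>\<^bsub>G\<^esub> x" for x by (auto dest: adj_not_same)
  show "card (verts G) = detour_order G + k" using G by simp
  show "length p \<le> detour_order G"
    if "distinct p" "set p \<subseteq> verts G" "successively (dominates G) p" for p
  proof (cases "p = []")
    case False
    then show ?thesis
      using that finite_vpaths[of G] unfolding detour_order_def
      by (intro Max_ge) (auto simp: vpath_iff_successively)
  qed simp
  show "\<exists>p. distinct p \<and> set p = verts G - S \<and> successively (dominates G) p"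
    if S: "S \<subseteq> verts G" "card S = k" for S
  proof -
    obtain p where p: "hamilton_path p (G \<restriction> (verts G - S))" using G(3)[OF S] by blast
    then have "successively (dominates G) p"
      by (auto simp: hamilton_path_def vpath_iff_successively
          elim!: successively_mono dest: dominates_induce_subgraphD)
    then show ?thesis using p by (auto simp: hamilton_path_def vpath_iff_successively)
  qed
qed

lemma detour_order_pos:
  assumes "finite (verts G)" "v \<in> verts G"
  shows "1 \<le> detour_order G"
proof -
  have "vpath [v] G" using assms by (simp add: vpath_iff_successively)
  then have "length [v] \<le> detour_order G"
    unfolding detour_order_def using finite_vpaths[OF assms(1)]
    by (intro Max_ge finite_imageI) blast+
  then show ?thesis by simp
qed

theorem theorem1p4:
  fixes G :: "('a, 'b) pre_digraph" and n k :: nat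
  assumes "n \<ge> 1" and "k \<ge> 1"
    and nondegenerate: "k = 1 \<or> n \<noteq> k + 1"
    and "G \<in> Pi_graphs n k"
  shows "real (max_degree G) \<le> (real n - (real k)\<^sup>2) / 2"
proof -
  have G: "graph G" "card (verts G) = n" "detour_order G + k = n"
    using assms(4) by (auto simp: Pi_graphs_def)
  interpret graph G by (rule G(1))
  interpret k_deleted_traceable "verts G" "dominates G" k "detour_order G"
    using assms(4) by (rule Pi_graphs_imp_k_deleted_traceable)
  have "verts G \<noteq> {}" using G assms(1) by auto
  then have "max_degree G \<in> out_degree G ` verts G"
    unfolding max_degree_def by (intro Max_in) auto
  then obtain v where v: "v \<in> verts G" "max_degree G = card (nbrs v)"
    by (auto simp: out_degree_conv_card_dominates nbrs_def)
  \<comment> \<open>Together with \<open>n \<noteq> k + 1\<close> this makes the detour order at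
    least 2 when \<open>k \<noteq> 1\<close>, as \<open>degree_bound\<close> requires.\<close>
  have "1 \<le> detour_order G" using detour_order_pos[OF _ v(1)] by simp
  then have "2 * max_degree G + k\<^sup>2 \<le> n"
    using degree_bound[OF assms(2) _ v(1)] v nondegenerate G by force
  then have "real (2 * max_degree G + k\<^sup>2) \<le> real n" by (rule of_nat_mono)
  then show ?thesis by simp
qed

end
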